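(* Let $\mathfrak g$ be a finite-dimensional Lie algebra with a non-degenerate, $\mathrm{ad}$-invariant, symmetric bilinear form $B$. Let $d_1,d_2,d_3$ be skew-symmetric endomorphisms of $(\mathfrak g,B)$ and set $\omega_i(x,y)=B(d_i(x),y)$ for all $x,y\in\mathfrak g$, $i=1,2,3$. Then $(d_1,d_2,d_3)$ is an $\varepsilon$-hyper differential operator on $\mathfrak g$ if and only if $(\omega_1,\omega_2,\omega_3)$ is an $\varepsilon$-hyper symplectic structure on $\mathfrak g$.
   Context: Everything is over a ground field $\mathbb K$ of characteristic different from $2$; $\varepsilon=(\varepsilon_1,\varepsilon_2,\varepsilon_3)$ with $\varepsilon_i\in\{1,-1\}$. $B$ is $\mathrm{ad}$-invariant if $B([x,y],z)+B(y,[x,z])=0$ for all $x,y,z\in\mathfrak g$. A skew-symmetric endomorphism of $(\mathfrak g,B)$ is a linear map $\varphi:\mathfrak g\to\mathfrak g$ with $B(\varphi(x),y)=-B(\varphi(y),x)$ for all $x,y\in\mathfrak g$. For a representation $(V;\rho)$ of $\mathfrak g$, a relative differential operator is a linear map $d:\mathfrak g\to V$ with $d[x,y]=\rho(x)d(y)-\rho(y)d(x)$ for all $x,y$. Invertible relative differential operators $d_1,d_2,d_3$ with respect to $(V;\rho)$ form an $\varepsilon$-hyper relative differential operator if $(d_{i-1}^{-1}\circ d_{i+1})^2=\varepsilon_i\,\mathrm{Id}_{\mathfrak g}$ for $i=1,2,3$ (indices mod 3). An $\varepsilon$-hyper differential operator on $\mathfrak g$ is a triple of invertible derivations $(d_1,d_2,d_3)$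 of $\mathfrak g$ which is an $\varepsilon$-hyper relative differential operator with respect to the adjoint representation $(\mathfrak g;\mathrm{ad})$. A symplectic structure on $\mathfrak g$ is a nondegenerate skew-symmetric bilinear form $\omega$ with $\omega([x,y],z)+\omega([z,x],y)+\omega([y,z],x)=0$ for all $x,y,z$; define $\omega^\natural:\mathfrak g\to\mathfrak g^*$ by $\langle\omega^\natural(x),y\rangle=\omega(x,y)$. An $\varepsilon$-hyper symplectic structure is a triple $(\omega_1,\omega_2,\omega_3)$ of symplectic structures such that $(\omega_1^\natural,\omega_2^\natural,\omega_3^\natural)$ is an $\varepsilon$-hyper relative differential operator with respect to the coadjoint representation $(\mathfrak g^*;\mathrm{ad}^* )$. *)

theory Defs
  imports
    Complex_Main
    "HOL-Library.Function_Algebras"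
    "HOL-Library.Numeral_Type"
begin

definition bilinear_form :: "('k::field \<Rightarrow> 'g::ab_group_add \<Rightarrow> 'g) \<Rightarrow> ('g \<Rightarrow> 'g \<Rightarrow> 'k) \<Rightarrow> bool" where
  "bilinear_form scale B \<longleftrightarrow>
     (\<forall>x. Vector_Spaces.linear scale (*) (\<lambda>y. B x y)) \<and>
     (\<forall>y. Vector_Spaces.linear scale (*) (\<lambda>x. B x y))"

definition symmetric_form :: "('g \<Rightarrow> 'g \<Rightarrow> 'k) \<Rightarrow> bool" where
  "symmetric_form B \<longleftrightarrow> (\<forall>x y. B x y = B y x)"

definition skew_symmetric_form :: "('g \<Rightarrow> 'g \<Rightarrow> 'k::ab_group_add) \<Rightarrow> bool" where
  "skew_symmetric_form B \<longleftrightarrow> (\<forall>x y. B x y = - B y x)"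

text \<open>Used only for symmetric or skew-symmetric forms, whose left and right radicals coincide.\<close>

definition nondegenerate_form :: "('g::zero \<Rightarrow> 'g \<Rightarrow> 'k::zero) \<Rightarrow> bool" where
  "nondegenerate_form B \<longleftrightarrow> (\<forall>x. (\<forall>y. B x y = 0) \<longrightarrow> x = 0)"

definition skew_symmetric_endomorphism ::
    "('k::field \<Rightarrow> 'g::ab_group_add \<Rightarrow> 'g) \<Rightarrow> ('g \<Rightarrow> 'g \<Rightarrow> 'k) \<Rightarrow> ('g \<Rightarrow> 'g) \<Rightarrow> bool" where
  "skew_symmetric_endomorphism scale B \<phi> \<longleftrightarrow>
     Vector_Spaces.linear scale scale \<phi> \<and> (\<forall>x y. B (\<phi> x) y = - B (\<phi> y) x)"

definition dual_scale :: "'k::field \<Rightarrow> ('g \<Rightarrow> 'k) \<Rightarrow> ('g \<Rightarrow> 'k)" where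
  "dual_scale c f = (\<lambda>x. c * f x)"

text \<open>The map \<open>\<omega>\<^sup>\<natural>\<close>; it takes values in the dual space when \<open>\<omega>\<close> is bilinear.\<close>

definition form_map :: "('g \<Rightarrow> 'g \<Rightarrow> 'k) \<Rightarrow> 'g \<Rightarrow> ('g \<Rightarrow> 'k)" where
  "form_map \<omega> x = (\<lambda>y. \<omega> x y)"

locale lie_algebra = vector_space scale
  for scale :: "'k::field \<Rightarrow> 'g::ab_group_add \<Rightarrow> 'g" +
  fixes bracket :: "'g \<Rightarrow> 'g \<Rightarrow> 'g"
  assumes linear_bracket_right: "Vector_Spaces.linear scale scale (\<lambda>y. bracket x y)"
    and linear_bracket_left: "Vector_Spaces.linear scale scale (\<lambda>x. bracket x y)"
    and bracket_self: "bracket x x = 0"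
    and jacobi: "bracket x (bracket y z) + bracket y (bracket z x) + bracket z (bracket x y) = 0"

text \<open>The representation space is a subspace \<open>V\<close> of an ambient type, since the dual of \<open>'g\<close> is
  only a subspace of \<open>'g \<Rightarrow> 'k\<close>. The action \<open>\<rho>\<close> is constrained on \<open>V\<close> only.\<close>

locale lie_representation = lie_algebra scale bracket + V: vector_space scaleV
  for scale :: "'k::field \<Rightarrow> 'g::ab_group_add \<Rightarrow> 'g"
    and bracket :: "'g \<Rightarrow> 'g \<Rightarrow> 'g"
    and scaleV :: "'k \<Rightarrow> 'v::ab_group_add \<Rightarrow> 'v" +
  fixes V :: "'v set" and \<rho> :: "'g \<Rightarrow> 'v \<Rightarrow> 'v"
  assumes subspace_V: "V.subspace V"
    and rho_closed: "v \<in> V \<Longrightarrow> \<rho> x v \<in> V"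
    and rho_add: "v \<in> V \<Longrightarrow> w \<in> V \<Longrightarrow> \<rho> x (v + w) = \<rho> x v + \<rho> x w"
    and rho_scale: "v \<in> V \<Longrightarrow> \<rho> x (scaleV c v) = scaleV c (\<rho> x v)"
    and rho_add_left: "v \<in> V \<Longrightarrow> \<rho> (x + y) v = \<rho> x v + \<rho> y v"
    and rho_scale_left: "v \<in> V \<Longrightarrow> \<rho> (scale c x) v = scaleV c (\<rho> x v)"
    and rho_bracket: "v \<in> V \<Longrightarrow> \<rho> (bracket x y) v = \<rho> x (\<rho> y v) - \<rho> y (\<rho> x v)"
begin

definition relative_differential_operator :: "('g \<Rightarrow> 'v) \<Rightarrow> bool" where
  "relative_differential_operator d \<longleftrightarrow>
     Vector_Spaces.linear scale scaleV d \<and> range d \<subseteq> V \<and>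
     (\<forall>x y. d (bracket x y) = \<rho> x (d y) - \<rho> y (d x))"

text \<open>Triples are indexed by the three-element type \<open>3\<close>, whose arithmetic is modulo 3, so that
  index 3 is \<open>0\<close>. As each \<open>d j\<close> is a bijection onto \<open>V\<close>, \<open>inv (d j)\<close> is its inverse on \<open>V\<close>.\<close>

definition hyper_relative_differential_operator :: "(3 \<Rightarrow> 'k) \<Rightarrow> (3 \<Rightarrow> 'g \<Rightarrow> 'v) \<Rightarrow> bool" where
  "hyper_relative_differential_operator \<epsilon> d \<longleftrightarrow>
     (\<forall>i. relative_differential_operator (d i) \<and> bij_betw (d i) UNIV V) \<and>
     (\<forall>i. (inv (d (i - 1)) \<circ> d (i + 1)) ^^ 2 = (\<lambda>x. scale (\<epsilon> i) x))"

end

context lie_algebra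
begin

definition ad_invariant :: "('g \<Rightarrow> 'g \<Rightarrow> 'k) \<Rightarrow> bool" where
  "ad_invariant B \<longleftrightarrow> (\<forall>x y z. B (bracket x y) z + B y (bracket x z) = 0)"

definition derivation :: "('g \<Rightarrow> 'g) \<Rightarrow> bool" where
  "derivation d \<longleftrightarrow> Vector_Spaces.linear scale scale d \<and>
     (\<forall>x y. d (bracket x y) = bracket (d x) y + bracket x (d y))"

definition ad :: "'g \<Rightarrow> 'g \<Rightarrow> 'g" where
  "ad x y = bracket x y"

definition dual_space :: "('g \<Rightarrow> 'k) set" where
  "dual_space = {f. Vector_Spaces.linear scale (*) f}"

definition coad :: "'g \<Rightarrow> ('g \<Rightarrow> 'k) \<Rightarrow> ('g \<Rightarrow> 'k)" where
  "coad x f = (\<lambda>y. - f (ad x y))"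

lemma linear_iff: "Vector_Spaces.linear scale (*) f \<longleftrightarrow>
    (\<forall>x y. f (x + y) = f x + f y) \<and> (\<forall>c x. f (scale c x) = c * f x)"
proof -
  have "vector_space ((*) :: 'k \<Rightarrow> 'k \<Rightarrow> 'k)"
    by unfold_locales (auto simp: algebra_simps)
  then show ?thesis
    using vector_space_axioms
    by (auto simp: Vector_Spaces.linear_iff)
qed

lemma bracket_simps:
  "bracket x (y + z) = bracket x y + bracket x z"
  "bracket (x + y) z = bracket x z + bracket y z"
  "bracket x (scale c y) = scale c (bracket x y)"
  "bracket (scale c x) y = scale c (bracket x y)"
  using linear_bracket_left linear_bracket_right by (auto simp: Vector_Spaces.linear_iff)

lemma bracket_skew: "bracket x y = - bracket y x"
proof -
  have "bracket (x + y) (x + y) = 0" by (rule bracket_self)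
  then have "bracket x y + bracket y x = 0"
    by (simp only: bracket_simps) (simp add: bracket_self add.commute)
  then show ?thesis by (rule eq_neg_iff_add_eq_0[THEN iffD2])
qed

lemma bracket_minus: "bracket x (- y) = - bracket x y"
  by (metis bracket_simps(3) scale_minus_left scale_one)

lemma bracket_bracket:
  "bracket (bracket x y) z = bracket x (bracket y z) - bracket y (bracket x z)"
proof -
  have "bracket (bracket x y) z = - bracket z (bracket x y)"
    by (rule bracket_skew)
  also have "\<dots> = bracket x (bracket y z) + bracket y (bracket z x)"
    using jacobi[of x y z] by (simp add: minus_unique add.commute)
  also have "bracket y (bracket z x) = - bracket y (bracket x z)"
    using bracket_skew[of z x] bracket_minus by simp
  finally show ?thesis by simp
qed

sublocale adjoint: lie_representation scale bracket scale UNIV ad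
  by unfold_locales (auto simp: ad_def bracket_simps bracket_bracket)

sublocale coadjoint: lie_representation scale bracket dual_scale dual_space coad
proof -
  interpret D: vector_space "dual_scale :: 'k \<Rightarrow> ('g \<Rightarrow> 'k) \<Rightarrow> _"
    by unfold_locales (auto simp: dual_scale_def fun_eq_iff algebra_simps)
  have minus: "f (x - y) = f x - f y" if "f \<in> dual_space" for f :: "'g \<Rightarrow> 'k" and x y
  proof -
    have "f ((x - y) + y) = f (x - y) + f y"
      using that unfolding dual_space_def linear_iff by blast
    then show ?thesis by simp
  qed
  show "lie_representation scale bracket dual_scale dual_space coad"
  proof
    show "D.subspace dual_space"
      unfolding D.subspace_def dual_space_def linear_iff
      by (auto simp: dual_scale_def algebra_simps)
  qed (auto simp: minus coad_def ad_def dual_scale_def fun_eq_iff bracket_bracket,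
       auto simp: dual_space_def linear_iff bracket_simps algebra_simps)
qed

definition hyper_differential_operator :: "(3 \<Rightarrow> 'k) \<Rightarrow> (3 \<Rightarrow> 'g \<Rightarrow> 'g) \<Rightarrow> bool" where
  "hyper_differential_operator \<epsilon> d \<longleftrightarrow>
     (\<forall>i. derivation (d i) \<and> bij (d i)) \<and> adjoint.hyper_relative_differential_operator \<epsilon> d"

definition symplectic_structure :: "('g \<Rightarrow> 'g \<Rightarrow> 'k) \<Rightarrow> bool" where
  "symplectic_structure \<omega> \<longleftrightarrow>
     bilinear_form scale \<omega> \<and> skew_symmetric_form \<omega> \<and> nondegenerate_form \<omega> \<and>
     (\<forall>x y z. \<omega> (bracket x y) z + \<omega> (bracket z x) y + \<omega> (bracket y z) x = 0)"

definition hyper_symplectic_structure :: "(3 \<Rightarrow> 'k) \<Rightarrow> (3 \<Rightarrow> 'g \<Rightarrow> 'g \<Rightarrow> 'k) \<Rightarrow> bool" where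
  "hyper_symplectic_structure \<epsilon> \<omega> \<longleftrightarrow>
     (\<forall>i. symplectic_structure (\<omega> i)) \<and>
     coadjoint.hyper_relative_differential_operator \<epsilon> (\<lambda>i. form_map (\<omega> i))"

end

end

theory Submission
  imports Defs
begin

text \<open>
  A nondegenerate form \<open>B\<close> on a finite-dimensional space identifies \<open>'g\<close> with its dual via
  \<open>x \<mapsto> B x\<close>, and ad-invariance of \<open>B\<close> says exactly that this identification is an isomorphism
  from the adjoint to the coadjoint representation. Relative differential operators,
  and the relations between three of them, are transported by composition with an isomorphism of
  representations: the isomorphism cancels in \<open>(b \<circ> d)\<inverse> \<circ> (b \<circ> d')\<close>. Since \<open>\<omega> i\<close>, read as a map
  into the dual, is the composite of \<open>d i\<close> with \<open>B\<close>, the triple \<open>d\<close> is hyper for the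
  adjoint representation iff \<open>\<omega>\<close> is hyper for the coadjoint one.

  The hyper conditions imply the additional clauses on both sides. Relative differential operators
  for the adjoint representation are derivations by skew-symmetry of the bracket. Skew-symmetry
  of \<open>d i\<close> with respect to \<open>B\<close> is skew-symmetry of \<open>\<omega> i\<close>, and for a skew form whose map into
  the dual is a relative differential operator, the operator identity is the cocycle identity;
  bijectivity onto the dual gives nondegeneracy.
\<close>

section \<open>Transport along isomorphisms of representations\<close>

text \<open>As the representation spaces are subspaces of ambient types, the conditions on the
  isomorphism \<open>b\<close> concern its restriction to \<open>V\<close> only.\<close>

locale lie_representation_isomorphism =
  dom: lie_representation scale bracket scaleV V \<rho> +
  cod: lie_representation scale bracket scaleW W \<sigma>
  for scale :: "'k::field \<Rightarrow> 'g::ab_group_add \<Rightarrow> 'g"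
    and bracket :: "'g \<Rightarrow> 'g \<Rightarrow> 'g"
    and scaleV :: "'k \<Rightarrow> 'v::ab_group_add \<Rightarrow> 'v" and V \<rho>
    and scaleW :: "'k \<Rightarrow> 'w::ab_group_add \<Rightarrow> 'w" and W \<sigma> +
  fixes b :: "'v \<Rightarrow> 'w"
  assumes bij: "bij_betw b V W"
    and map_add: "v \<in> V \<Longrightarrow> v' \<in> V \<Longrightarrow> b (v + v') = b v + b v'"
    and map_scale: "v \<in> V \<Longrightarrow> b (scaleV c v) = scaleW c (b v)"
    and map_action: "v \<in> V \<Longrightarrow> b (\<rho> x v) = \<sigma> x (b v)"
begin

lemma map_diff:
  assumes "v \<in> V" "v' \<in> V"
  shows "b (v - v') = b v - b v'"
proof -
  have "v - v' \<in> V"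
    using assms dom.V.subspace_diff dom.subspace_V by blast
  then have "b v = b (v - v') + b v'"
    using assms map_add[of "v - v'" v'] by simp
  then show ?thesis by simp
qed

lemma map_eq_iff: "v \<in> V \<Longrightarrow> v' \<in> V \<Longrightarrow> b v = b v' \<longleftrightarrow> v = v'"
  using bij by (auto simp: bij_betw_def inj_on_def)

lemma linear_comp_iff:
  assumes "range d \<subseteq> V"
  shows "Vector_Spaces.linear scale scaleW (b \<circ> d) \<longleftrightarrow> Vector_Spaces.linear scale scaleV d"
proof -
  have d: "d x \<in> V" for x
    using assms by blast
  have "b (d (x + y)) = b (d x) + b (d y) \<longleftrightarrow> d (x + y) = d x + d y" for x y
    using d map_eq_iff map_add dom.V.subspace_add[OF dom.subspace_V] by metis
  moreover have "b (d (scale c x)) = scaleW c (b (d x)) \<longleftrightarrow> d (scale c x) = scaleV c (d x)" for c x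
    using d map_eq_iff map_scale dom.V.subspace_scale[OF dom.subspace_V] by metis
  ultimately show ?thesis
    using dom.vector_space_axioms dom.V.vector_space_axioms cod.V.vector_space_axioms
    by (simp add: Vector_Spaces.linear_iff)
qed

lemma relative_differential_operator_comp_iff:
  assumes "range d \<subseteq> V"
  shows "cod.relative_differential_operator (b \<circ> d) \<longleftrightarrow> dom.relative_differential_operator d"
proof -
  have d: "d x \<in> V" for x
    using assms by blast
  have mem: "\<rho> x (d y) - \<rho> y (d x) \<in> V" for x y
    using d dom.rho_closed dom.V.subspace_diff dom.subspace_V by blast
  have "b (\<rho> x (d y) - \<rho> y (d x)) = \<sigma> x (b (d y)) - \<sigma> y (b (d x))" for x y
    using d by (simp add: map_diff map_action dom.rho_closed)
  then have "b (d (bracket x y)) = \<sigma> x (b (d y)) - \<sigma> y (b (d x))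
      \<longleftrightarrow> d (bracket x y) = \<rho> x (d y) - \<rho> y (d x)" for x y
    using map_eq_iff[OF d mem] by metis
  moreover have "range (b \<circ> d) \<subseteq> W"
    using d bij by (auto simp: bij_betw_def)
  ultimately show ?thesis
    using assms linear_comp_iff[OF assms]
    by (simp add: cod.relative_differential_operator_def dom.relative_differential_operator_def)
qed

lemma bij_comp_iff:
  assumes "range d \<subseteq> V"
  shows "bij_betw (b \<circ> d) UNIV W \<longleftrightarrow> bij_betw d UNIV V"
  using bij_betw_comp_iff2[OF bij assms] by simp

lemma inv_comp_cancel:
  assumes "bij_betw d UNIV V" and "range d' \<subseteq> V"
  shows "inv (b \<circ> d) \<circ> (b \<circ> d') = inv d \<circ> d'"
proof
  fix x
  have surj: "range d = V" and "inj d"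
    using assms(1) by (auto simp: bij_betw_def)
  then obtain y where y: "d' x = d y"
    using assms(2) by blast
  have "bij_betw (b \<circ> d) UNIV W"
    using bij_comp_iff[of d] assms(1) surj by simp
  then have "inj (b \<circ> d)"
    by (simp add: bij_betw_def)
  then have "inv (b \<circ> d) ((b \<circ> d) y) = y"
    by (rule inv_f_f)
  then show "(inv (b \<circ> d) \<circ> (b \<circ> d')) x = (inv d \<circ> d') x"
    using y \<open>inj d\<close> by simp
qed

lemma hyper_relative_differential_operator_comp_iff:
  fixes d :: "3 \<Rightarrow> 'g \<Rightarrow> 'v"
  assumes "\<And>i. range (d i) \<subseteq> V"
  shows "cod.hyper_relative_differential_operator \<epsilon> (\<lambda>i. b \<circ> d i)
    \<longleftrightarrow> dom.hyper_relative_differential_operator \<epsilon> d"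
proof (cases "\<forall>i. bij_betw (d i) UNIV V")
  case True
  then show ?thesis
    unfolding cod.hyper_relative_differential_operator_def
      dom.hyper_relative_differential_operator_def
    by (simp add: relative_differential_operator_comp_iff bij_comp_iff inv_comp_cancel assms
        del: comp_apply)
next
  case False
  then show ?thesis
    unfolding cod.hyper_relative_differential_operator_def
      dom.hyper_relative_differential_operator_def
    by (meson assms bij_comp_iff)
qed

end

section \<open>Nondegenerate forms and the dual space\<close>

text \<open>Injectivity is nondegeneracy. For surjectivity, \<open>x \<mapsto> (\<Sum>e\<in>Basis. B x e \<cdot> e)\<close> plays the role
  of \<open>x \<mapsto> B x\<close> as an endomorphism: it records the functional \<open>B x\<close> by its values on the
  basis, so it is injective and therefore, by dimension, surjective.\<close>

lemma (in finite_dimensional_vector_space) nondegenerate_form_bij_dual: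
  assumes bil: "bilinear_form scale B" and nondeg: "nondegenerate_form B"
  shows "bij_betw (form_map B) UNIV {f. Vector_Spaces.linear scale (*) f}"
proof -
  interpret form: vector_space_pair scale "(*) :: 'a \<Rightarrow> 'a \<Rightarrow> 'a"
    by unfold_locales (auto simp: algebra_simps)
  have lin: "Vector_Spaces.linear scale (*) (B x)" for x
    using bil by (simp add: bilinear_form_def)
  have add: "B (x + y) z = B x z + B y z" and scl: "B (scale c x) z = c * B x z" for c x y z
    using bil by (simp_all add: bilinear_form_def Vector_Spaces.linear_iff)
  have diff: "B (x - y) z = B x z - B y z" for x y z
    using add[of "x - y" y z] by simp
  define T where "T x = (\<Sum>e\<in>Basis. scale (B x e) e)" for x
  have T: "Vector_Spaces.linear scale scale T"
    by (auto simp: T_def Vector_Spaces.linear_iff vector_space_axioms add scl scale_left_distrib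
        sum.distrib scale_sum_right)
  have ext: "f = g" if "Vector_Spaces.linear scale (*) f" "Vector_Spaces.linear scale (*) g"
    "\<And>e. e \<in> Basis \<Longrightarrow> f e = g e" for f g :: "'b \<Rightarrow> 'a"
    using form.linear_eq_on_span[OF that] span_Basis by auto
  have coords: "f e = g e"
    if "(\<Sum>e\<in>Basis. scale (f e) e) = (\<Sum>e\<in>Basis. scale (g e) e)" "e \<in> Basis"
    for f g :: "'b \<Rightarrow> 'a" and e
  proof -
    have "(\<Sum>e\<in>Basis. scale (f e - g e) e) = 0"
      using that(1) by (simp add: scale_left_diff_distrib sum_subtractf)
    then have "f e - g e = 0"
      using that(2) independentD[OF independent_Basis finite_Basis subset_refl,
        where u = "\<lambda>e. f e - g e"] by simp
    then show ?thesis by simp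
  qed
  have inj: "inj (form_map B)"
  proof (rule injI)
    fix x y assume "form_map B x = form_map B y"
    then have "B (x - y) z = 0" for z
      by (simp add: form_map_def fun_eq_iff diff)
    then have "x - y = 0"
      using nondeg unfolding nondegenerate_form_def by blast
    then show "x = y" by simp
  qed
  have "inj T"
  proof (rule injI)
    fix x y assume "T x = T y"
    then have "B x = B y"
      unfolding T_def using ext[OF lin lin] coords by blast
    then show "x = y"
      using inj by (simp add: form_map_def inj_def)
  qed
  with T have "surj T"
    by (rule linear_inj_imp_surj)
  have "f \<in> range (form_map B)" if f: "Vector_Spaces.linear scale (*) f" for f
  proof -
    obtain x where "T x = (\<Sum>e\<in>Basis. scale (f e) e)"
      using \<open>surj T\<close> by (metis surjD)
    then have "B x = f"
      unfolding T_def using ext[OF lin f] coords by blast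
    then show ?thesis
      by (auto simp: form_map_def)
  qed
  then show ?thesis
    using inj lin by (auto simp: bij_betw_def form_map_def)
qed

context lie_algebra
begin

text \<open>The intertwining property is ad-invariance read as \<open>B [x, y] z = - B y [x, z]\<close>.\<close>

lemma invariant_form_isomorphism:
  assumes "finite_dimensional_vector_space scale Basis"
    and bil: "bilinear_form scale B" and "nondegenerate_form B" and inv: "ad_invariant B"
  shows "lie_representation_isomorphism scale bracket scale UNIV ad dual_scale dual_space coad
    (form_map B)"
proof
  show "bij_betw (form_map B) UNIV dual_space"
    using finite_dimensional_vector_space.nondegenerate_form_bij_dual[OF assms(1-3)]
    by (simp add: dual_space_def)
  show "form_map B (v + v') = form_map B v + form_map B v'" for v v'
    using bil by (simp add: form_map_def bilinear_form_def Vector_Spaces.linear_iff fun_eq_iff)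
  show "form_map B (scale c v) = dual_scale c (form_map B v)" for c v
    using bil by (simp add: form_map_def dual_scale_def bilinear_form_def Vector_Spaces.linear_iff)
  show "form_map B (ad x v) = coad x (form_map B v)" for x v
    using inv by (simp add: form_map_def coad_def ad_def ad_invariant_def fun_eq_iff
        eq_neg_iff_add_eq_0)
qed

section \<open>Derivations and symplectic structures as relative differential operators\<close>

lemma derivation_iff_relative_differential_operator:
  "derivation d \<longleftrightarrow> adjoint.relative_differential_operator d"
proof -
  have "bracket (d x) y + bracket x (d y) = ad x (d y) - ad y (d x)" for x y
    using bracket_skew[of "d x" y] by (simp add: ad_def)
  then show ?thesis
    by (simp add: derivation_def adjoint.relative_differential_operator_def)
qed

text \<open>Moving each bracket to the first argument by skew-symmetry turns the coadjoint
  identity \<open>\<omega> [x, y] z = - \<omega> y [x, z] + \<omega> x [y, z]\<close> into the cocycle identity.\<close>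

lemma symplectic_structure_if_relative_differential_operator:
  assumes bil: "bilinear_form scale \<omega>" and skew: "skew_symmetric_form \<omega>"
    and "nondegenerate_form \<omega>"
    and rdo: "coadjoint.relative_differential_operator (form_map \<omega>)"
  shows "symplectic_structure \<omega>"
proof -
  have sk: "\<omega> x y = - \<omega> y x" for x y
    using skew unfolding skew_symmetric_form_def by blast
  have "\<omega> (bracket x y) z + \<omega> (bracket z x) y + \<omega> (bracket y z) x = 0" for x y z
  proof -
    have "form_map \<omega> (bracket x y) = coad x (form_map \<omega> y) - coad y (form_map \<omega> x)"
      using rdo by (simp add: coadjoint.relative_differential_operator_def)
    then have "\<omega> (bracket x y) z = - \<omega> y (bracket x z) + \<omega> x (bracket y z)"
      by (simp add: form_map_def coad_def ad_def fun_eq_iff)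
    moreover have "\<omega> y (bracket x z) = \<omega> (bracket z x) y"
    proof -
      have "Vector_Spaces.linear scale (*) (\<omega> y)"
        using bil by (simp add: bilinear_form_def)
      then have "\<omega> y (- bracket z x) = - \<omega> y (bracket z x)"
        by (metis linear_iff mult_minus1 scale_minus_left scale_one)
      then show ?thesis
        using bracket_skew[of x z] sk[of y "bracket z x"] by simp
    qed
    moreover have "\<omega> x (bracket y z) = - \<omega> (bracket y z) x"
      by (rule sk)
    ultimately show ?thesis by simp
  qed
  then show ?thesis
    using assms by (simp add: symplectic_structure_def)
qed

text \<open>The bijectivity onto the dual contained in the hyper condition supplies nondegeneracy.\<close>

lemma hyper_symplectic_structure_iff:
  assumes "\<And>i. bilinear_form scale (\<omega> i)" and "\<And>i. skew_symmetric_form (\<omega> i)"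
  shows "hyper_symplectic_structure \<epsilon> \<omega>
    \<longleftrightarrow> coadjoint.hyper_relative_differential_operator \<epsilon> (\<lambda>i. form_map (\<omega> i))"
proof -
  have "symplectic_structure (\<omega> i)"
    if hyper: "coadjoint.hyper_relative_differential_operator \<epsilon> (\<lambda>i. form_map (\<omega> i))" for i
  proof (rule symplectic_structure_if_relative_differential_operator)
    show "coadjoint.relative_differential_operator (form_map (\<omega> i))"
      using hyper by (simp add: coadjoint.hyper_relative_differential_operator_def)
    have inj: "inj (form_map (\<omega> i))"
      using hyper by (simp add: coadjoint.hyper_relative_differential_operator_def bij_betw_def)
    have "\<omega> i 0 y = 0" for y
    proof -
      have "Vector_Spaces.linear scale (*) (\<lambda>x. \<omega> i x y)"
        using assms(1) by (simp add: bilinear_form_def)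
      then show ?thesis
        by (metis linear_iff mult_zero_left scale_zero_left)
    qed
    then show "nondegenerate_form (\<omega> i)"
      using inj by (auto simp: nondegenerate_form_def form_map_def inj_def fun_eq_iff)
  qed (use assms in auto)
  then show ?thesis
    by (auto simp: hyper_symplectic_structure_def)
qed

lemma hyper_differential_operator_iff:
  "hyper_differential_operator \<epsilon> d \<longleftrightarrow> adjoint.hyper_relative_differential_operator \<epsilon> d"
  by (auto simp: hyper_differential_operator_def adjoint.hyper_relative_differential_operator_def
      derivation_iff_relative_differential_operator)

end

section \<open>Hyper differential operators and hyper symplectic structures\<close>

theorem theorem5p6:
  fixes scale :: "'k::field \<Rightarrow> 'g::ab_group_add \<Rightarrow> 'g"
    and bracket :: "'g \<Rightarrow> 'g \<Rightarrow> 'g"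
    and Basis :: "'g set"
    and B :: "'g \<Rightarrow> 'g \<Rightarrow> 'k"
    and \<epsilon> :: "3 \<Rightarrow> 'k"
    and d :: "3 \<Rightarrow> 'g \<Rightarrow> 'g"
    and \<omega> :: "3 \<Rightarrow> 'g \<Rightarrow> 'g \<Rightarrow> 'k"
  assumes "CHAR('k) \<noteq> 2"
    and "\<forall>i. \<epsilon> i \<in> {1, -1}"
    and "lie_algebra scale bracket"
    and "finite_dimensional_vector_space scale Basis"
    and "bilinear_form scale B"
    and "nondegenerate_form B"
    and "lie_algebra.ad_invariant bracket B"
    and "symmetric_form B"
    and "\<forall>i. skew_symmetric_endomorphism scale B (d i)"
    and "\<forall>i x y. \<omega> i x y = B (d i x) y"
  shows "lie_algebra.hyper_differential_operator scale bracket \<epsilon> d \<longleftrightarrow>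
         lie_algebra.hyper_symplectic_structure scale bracket \<epsilon> \<omega>"
proof -
  interpret lie_algebra scale bracket
    by fact
  interpret lie_representation_isomorphism scale bracket scale UNIV ad dual_scale dual_space coad
      "form_map B"
    using assms(4-7) by (rule invariant_form_isomorphism)
  have \<omega>: "\<omega> i = (\<lambda>x y. B (d i x) y)" for i
    using assms(10) by (simp add: fun_eq_iff)
  have d_linear: "Vector_Spaces.linear scale scale (d i)" for i
    using assms(9) unfolding skew_symmetric_endomorphism_def by blast
  have bil: "bilinear_form scale (\<omega> i)" for i
    using assms(5) d_linear[of i] by (simp add: \<omega> bilinear_form_def Vector_Spaces.linear_iff)
  have skew: "skew_symmetric_form (\<omega> i)" for i
    using assms(9) unfolding \<omega> skew_symmetric_form_def skew_symmetric_endomorphism_def by blast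
  have "form_map (\<omega> i) = form_map B \<circ> d i" for i
    by (simp add: \<omega> form_map_def fun_eq_iff)
  then have "hyper_symplectic_structure \<epsilon> \<omega>
      \<longleftrightarrow> coadjoint.hyper_relative_differential_operator \<epsilon> (\<lambda>i. form_map B \<circ> d i)"
    by (simp add: hyper_symplectic_structure_iff[OF bil skew])
  then show ?thesis
    by (simp add: hyper_relative_differential_operator_comp_iff hyper_differential_operator_iff)
qed

end
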